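(* For an integer $n\ge 1$ let $$W_n(k)=\prod_{r=0}^{n-1}\left(\frac{(2k+2r)^2}{(2k+2r-1)(2k+2r+1)}\right)^{(-1)^r\binom{n-1}{r}}\qquad(k=1,2,3,\ldots).$$ For every integer $M\ge 1$ there exist positive integers $a,b$ such that $$\prod_{k=1}^{\infty}W_{M+1}(k)^{k^{M}}=\frac{a\,\pi^{M!}}{b}.$$
   Context: The infinite product is the limit of the partial products over $k$, and the identity includes the assertion that it converges. *)

theory Defs
  imports Complex_Main
begin

(* The exponents (-1)^r * binomial(n-1, r) may be negative, hence powi. Only n >= 1 and k >= 1 are meaningful. *)
definition W :: "nat \<Rightarrow> nat \<Rightarrow> real" where
  "W n k = (\<Prod>r = 0..<n.
     ((2 * real k + 2 * real r)\<^sup>2 /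
      ((2 * real k + 2 * real r - 1) * (2 * real k + 2 * real r + 1)))
       powi ((-1) ^ r * int ((n - 1) choose r)))"

end

theory Submission
  imports Defs "HOL-Analysis.Gamma_Function"
begin

text \<open>
  Let \<open>w k\<close> be the Wallis factor \<open>(2k)\<^sup>2 / ((2k - 1) (2k + 1))\<close> and \<open>f = ln \<circ> w\<close>.  The alternating
  binomial exponents in \<open>W (M + 1)\<close> say that \<open>ln (W (M + 1) k)\<close> is the \<open>M\<close>-th iterated difference
  of \<open>f\<close> at \<open>k\<close>.  The logarithm of the product is therefore
  \<open>\<Sum>k. k ^ M * (\<Delta>\<^sup>M f) k\<close>, where \<open>\<Delta> f k = f k - f (k + 1)\<close>, and \<open>M\<close> summations by parts move all
  the differences from \<open>f\<close> to the weight \<open>k ^ M\<close>.  The \<open>M\<close>-th backward difference of \<open>k ^ M\<close>,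
  the power being replaced by \<open>0\<close> for negative arguments, is an integer for every \<open>k\<close>
  and equals \<open>M!\<close> as soon as \<open>k \<ge> M\<close>.  So the sum becomes \<open>M!\<close> times the logarithm of the Wallis
  product plus finitely many integer multiples of values \<open>f k\<close>: the product is
  \<open>(\<pi> / 2) ^ M!\<close> times finitely many integer powers of the rational numbers \<open>w k\<close>.

  It remains to see that the boundary terms vanish in the limit.  The boundary term of a summation
  by parts is the product of an \<open>i\<close>-th difference of \<open>k ^ M\<close> and an \<open>(M - i - 1)\<close>-th difference
  of \<open>f\<close>.  A mean value theorem for iterated differences (\<open>iterated_diff_mean_value\<close>) bounds the
  first by a multiple of \<open>k ^ (M - i)\<close>; since \<open>f\<close> is itself, up to sign, a second difference of the
  logarithm with step \<open>1/2\<close>, it also bounds the second by a multiple of \<open>1 / k ^ (M - i + 1)\<close>.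
  The product is \<open>O(1 / k)\<close>.
\<close>

section \<open>Iterated differences\<close>

text \<open>
  The difference \<open>f x - f (x + h)\<close> has the opposite of the usual sign, so that with \<open>n\<close> unit steps the
  coefficient of \<open>f (x + r)\<close> is \<open>(-1) ^ r * (n choose r)\<close>, without a factor depending on \<open>n\<close>.  A list
  of steps is used because unit and half steps are combined below.
\<close>

primrec iterated_diff :: "real list \<Rightarrow> (real \<Rightarrow> real) \<Rightarrow> real \<Rightarrow> real" where
  "iterated_diff [] f x = f x"
| "iterated_diff (h # hs) f x = iterated_diff hs f x - iterated_diff hs f (x + h)"

lemma iterated_diff_commute:
  "iterated_diff hs f x - iterated_diff hs f (x + h) = iterated_diff hs (\<lambda>y. f y - f (y + h)) x"
proof (induction hs arbitrary: x)
  case (Cons a hs)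
  have "iterated_diff hs f (x + h + a) = iterated_diff hs f (x + a + h)" by (simp add: add_ac)
  then show ?case by (simp add: Cons[symmetric])
qed simp

lemma iterated_diff_append:
  "iterated_diff (hs @ gs) f x = iterated_diff hs (iterated_diff gs f) x"
  by (induction hs arbitrary: x) auto

lemma iterated_diff_shift:
  "iterated_diff hs (\<lambda>y. f (y + c)) x = iterated_diff hs f (x + c)"
  by (induction hs arbitrary: x) (auto simp: add_ac)

lemma iterated_diff_uminus:
  "iterated_diff hs (\<lambda>y. - f y) x = - iterated_diff hs f x"
  by (induction hs arbitrary: x) auto

lemma iterated_diff_replicate:
  "iterated_diff (replicate n 1) f x = (\<Sum>r\<le>n. (-1) ^ r * real (n choose r) * f (x + real r))"
proof (induction n arbitrary: x)
  case (Suc n)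
  define c where "c r = (-1) ^ r * real (n choose r)" for r
  have c: "(-1) ^ Suc r * real (Suc n choose Suc r) = c (Suc r) - c r" for r
    by (simp add: c_def algebra_simps)
  have "(\<Sum>r\<le>Suc n. (-1) ^ r * real (Suc n choose r) * f (x + real r)) =
        f x + (\<Sum>r\<le>n. (c (Suc r) - c r) * f (x + real (Suc r)))"
    by (subst sum.atMost_Suc_shift, simp only: c) simp
  also have "\<dots> = (c 0 * f (x + real 0) + (\<Sum>r\<le>n. c (Suc r) * f (x + real (Suc r))))
                  - (\<Sum>r\<le>n. c r * f (x + 1 + real r))"
    by (simp add: left_diff_distrib sum_subtractf c_def add_ac)
  also have "c 0 * f (x + real 0) + (\<Sum>r\<le>n. c (Suc r) * f (x + real (Suc r)))
             = (\<Sum>r\<le>Suc n. c r * f (x + real r))"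
    by (subst sum.atMost_Suc_shift) simp
  also have "\<dots> = (\<Sum>r\<le>n. c r * f (x + real r))"
    by (simp add: c_def)
  finally show ?case
    by (simp add: Suc c_def)
qed simp

text \<open>
  With \<open>F i\<close> the \<open>i\<close>-th derivative of \<open>F 0\<close>, differencing with step \<open>h\<close> turns the family into
  \<open>F i y - F i (y + h)\<close>, again a family of successive derivatives.  The remaining steps thus produce a
  single difference of \<open>F (length hs)\<close> at some \<open>\<xi>\<close>, to which the ordinary mean value theorem applies.
\<close>

lemma iterated_diff_mean_value:
  assumes "\<And>h. h \<in> set hs \<Longrightarrow> h > 0"
    and "\<And>i y. i < length hs \<Longrightarrow> x \<le> y \<Longrightarrow> y \<le> x + sum_list hs \<Longrightarrow>
           (F i has_real_derivative F (Suc i) y) (at y)"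
  shows "\<exists>\<xi>. x \<le> \<xi> \<and> \<xi> \<le> x + sum_list hs \<and>
           iterated_diff hs (F 0) x = (\<Prod>h\<leftarrow>hs. - h) * F (length hs) \<xi>"
  using assms
proof (induction hs arbitrary: F)
  case (Cons h hs)
  let ?G = "\<lambda>i y. F i y - F i (y + h)"
  have h: "h > 0" and hs: "\<And>a. a \<in> set hs \<Longrightarrow> a > 0" using Cons.prems(1) by auto
  have "(?G i has_real_derivative ?G (Suc i) y) (at y)"
    if "i < length hs" "x \<le> y" "y \<le> x + sum_list hs" for i y
  proof -
    have 1: "(F i has_real_derivative F (Suc i) y) (at y)"
      using that h by (intro Cons.prems(2)) auto
    have "(F i has_real_derivative F (Suc i) (y + h)) (at (y + h))"
      using that h by (intro Cons.prems(2)) auto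
    then have "((\<lambda>y. F i (y + h)) has_real_derivative F (Suc i) (y + h)) (at y)"
      by (simp add: DERIV_shift)
    with 1 show ?thesis by (rule DERIV_diff)
  qed
  from Cons.IH[of ?G, OF hs this] obtain \<xi> where
    \<xi>: "x \<le> \<xi>" "\<xi> \<le> x + sum_list hs"
       "iterated_diff hs (?G 0) x = (\<Prod>a\<leftarrow>hs. - a) * ?G (length hs) \<xi>" by auto
  have "\<exists>z. \<xi> < z \<and> z < \<xi> + h \<and>
      F (length hs) (\<xi> + h) - F (length hs) \<xi> = (\<xi> + h - \<xi>) * F (Suc (length hs)) z"
    using h \<xi> by (intro MVT2 Cons.prems(2)) auto
  then obtain z where z: "\<xi> < z" "z < \<xi> + h"
      "?G (length hs) \<xi> = - h * F (Suc (length hs)) z" by (auto simp: algebra_simps)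
  show ?case
    using z \<xi> h by (intro exI[of _ z]) (simp add: iterated_diff_commute mult_ac)
qed auto

section \<open>The logarithm of the Wallis factor\<close>

text \<open>
  This is the logarithm of \<open>x\<^sup>2 / ((x - 1/2) (x + 1/2))\<close>, written as a second difference of \<open>ln\<close> up to sign.
\<close>

definition wallis_log :: "real \<Rightarrow> real" where
  "wallis_log x = 2 * ln x - ln (x - 1/2) - ln (x + 1/2)"

lemma exp_wallis_log:
  assumes "x > 1/2"
  shows "exp (wallis_log x) = (2 * x)\<^sup>2 / ((2 * x - 1) * (2 * x + 1))"
proof -
  have "exp (wallis_log x) = x * x / ((x - 1/2) * (x + 1/2))"
    using assms by (simp only: wallis_log_def mult_2 exp_diff exp_add) simp
  also have "\<dots> = (2 * x)\<^sup>2 / ((2 * x - 1) * (2 * x + 1))"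
    using assms by (simp add: divide_simps power2_eq_square) (simp add: algebra_simps)
  finally show ?thesis .
qed

lemma W_eq_exp_iterated_diff:
  assumes "k \<ge> 1"
  shows "W (Suc M) k = exp (iterated_diff (replicate M 1) wallis_log (real k))"
proof -
  have "W (Suc M) k = (\<Prod>r\<le>M. exp (wallis_log (real k + real r)) powi ((-1) ^ r * int (M choose r)))"
    unfolding W_def atLeast0LessThan lessThan_Suc_atMost
    using assms by (intro prod.cong) (simp_all add: exp_wallis_log distrib_left)
  also have "\<dots> = exp (\<Sum>r\<le>M. (-1) ^ r * real (M choose r) * wallis_log (real k + real r))"
    by (simp add: exp_sum exp_power_int)
  finally show ?thesis by (simp add: iterated_diff_replicate)
qed

text \<open>
  A \<open>j\<close>-th difference of \<open>wallis_log\<close> is a \<open>(j + 2)\<close>-th difference of \<open>ln\<close>, hence a multiple of the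
  \<open>(j + 2)\<close>-th derivative of \<open>ln\<close> at a point not to the left of \<open>x - 1/2\<close>.  The two half steps
  account for the two additional powers in the denominator, one more than is needed to cancel the
  growth of the weights.
\<close>

lemma iterated_diff_wallis_log_bound:
  assumes "x > 1/2"
  shows "\<bar>iterated_diff (replicate j 1) wallis_log x\<bar> \<le> fact (Suc j) / (x - 1/2) ^ (j + 2)"
proof -
  define F :: "nat \<Rightarrow> real \<Rightarrow> real" where
    "F i y = (case i of 0 \<Rightarrow> ln y | Suc n \<Rightarrow> (-1) ^ n * fact n * inverse y ^ Suc n)" for i y
  \<comment> \<open>\<open>F i\<close> is the \<open>i\<close>-th derivative of \<open>ln\<close>.\<close>
  define hs where "hs = replicate j (1::real) @ [1/2, 1/2]"
  have der: "(F i has_real_derivative F (Suc i) y) (at y)" if "y > 0" for i y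
  proof (cases i)
    case 0
    have "(ln has_real_derivative 1 / y) (at y)" using that by (auto intro!: derivative_eq_intros)
    then show ?thesis by (simp add: 0 F_def [abs_def] divide_inverse)
  next
    case (Suc n)
    have "((\<lambda>y. (-1) ^ n * fact n * inverse y ^ Suc n) has_real_derivative
            (-1) ^ n * fact n * (real (Suc n) * inverse y ^ n * - (inverse y ^ 2))) (at y)"
      using that
      by (intro DERIV_cmult DERIV_power_Suc[THEN DERIV_cong] DERIV_inverse_fun[THEN DERIV_cong])
         (auto intro!: derivative_eq_intros simp: power2_eq_square)
    then show ?thesis by (simp add: Suc F_def [abs_def] power2_eq_square mult_ac)
  qed
  have "\<exists>\<xi>. x - 1/2 \<le> \<xi> \<and> \<xi> \<le> x - 1/2 + sum_list hs \<and>
      iterated_diff hs (F 0) (x - 1/2) = (\<Prod>h\<leftarrow>hs. - h) * F (length hs) \<xi>"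
    using assms by (intro iterated_diff_mean_value der) (auto simp: hs_def)
  then obtain \<xi> where \<xi>: "x - 1/2 \<le> \<xi>"
      "iterated_diff hs (F 0) (x - 1/2) = (\<Prod>h\<leftarrow>hs. - h) * F (length hs) \<xi>" by blast
  have "\<xi> > 0" using \<xi>(1) assms by linarith
  have wallis_log_eq: "wallis_log = (\<lambda>y. - iterated_diff [1/2, 1/2] (F 0) (y + (-1/2)))"
    by (rule ext) (simp add: wallis_log_def F_def)
  have "iterated_diff (replicate j 1) wallis_log x = - iterated_diff hs (F 0) (x - 1/2)"
    by (simp only: wallis_log_eq iterated_diff_uminus iterated_diff_shift hs_def iterated_diff_append) simp
  also have "\<bar>\<dots>\<bar> = fact (Suc j) / (4 * \<xi> ^ (j + 2))"
  proof -
    have "\<bar>\<Prod>h\<leftarrow>hs. - h\<bar> = 1/4"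
      by (simp add: hs_def abs_mult prod_list_replicate power_abs)
    moreover have "F (length hs) \<xi> = (-1) ^ Suc j * fact (Suc j) * inverse \<xi> ^ (j + 2)"
      by (simp add: F_def hs_def del: power_Suc fact_Suc)
    then have "\<bar>F (length hs) \<xi>\<bar> = fact (Suc j) / \<xi> ^ (j + 2)"
      using \<open>\<xi> > 0\<close>
      by (simp add: abs_mult power_abs power_inverse divide_inverse del: power_Suc fact_Suc)
    ultimately show ?thesis by (simp only: \<xi>(2) abs_mult abs_minus_cancel times_divide_times_eq mult_1_left)
  qed
  also have "\<dots> \<le> fact (Suc j) / (x - 1/2) ^ (j + 2)"
    using \<xi> assms
    by (intro divide_left_mono order_trans[OF power_mono[OF \<xi>(1)]] mult_pos_pos) auto
  finally show ?thesis .
qed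

section \<open>Backward differences of powers\<close>

text \<open>
  The \<open>i\<close>-th backward difference of the function that is \<open>k ^ M\<close> for \<open>k \<ge> 0\<close> and \<open>0\<close> for \<open>k < 0\<close>.
  At \<open>k = 0\<close> truncated subtraction makes every difference of positive order \<open>0\<close>, which
  is the correct value when \<open>M \<ge> 1\<close>.  The values are integers because they become exponents of
  rational numbers.
\<close>

primrec power_bdiff :: "nat \<Rightarrow> nat \<Rightarrow> nat \<Rightarrow> int" where
  "power_bdiff M 0 k = int k ^ M"
| "power_bdiff M (Suc i) k = power_bdiff M i k - power_bdiff M i (k - 1)"

lemma power_bdiff_0 [simp]: "M \<ge> 1 \<Longrightarrow> power_bdiff M i 0 = 0"
  by (induction i) auto

text \<open>
  For \<open>k \<ge> i\<close> the cut-off at \<open>0\<close> is not felt, and a backward difference at \<open>k\<close> is a forward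
  difference at \<open>k - i\<close>; the sign compensates for the orientation of \<open>iterated_diff\<close>.
\<close>

lemma power_bdiff_eq_iterated_diff:
  assumes "i \<le> k"
  shows "real_of_int (power_bdiff M i k) =
           (-1) ^ i * iterated_diff (replicate i 1) (\<lambda>y. y ^ M) (real k - real i)"
  using assms
proof (induction i arbitrary: k)
  case (Suc i)
  define d where "d = iterated_diff (replicate i 1) (\<lambda>y. y ^ M)"
  have "real_of_int (power_bdiff M i k) = (-1) ^ i * d (real k - real (Suc i) + 1)"
    using Suc.IH[of k] Suc.prems by (simp add: d_def)
  moreover have "real_of_int (power_bdiff M i (k - 1)) = (-1) ^ i * d (real k - real (Suc i))"
    using Suc.IH[of "k - 1"] Suc.prems by (simp add: d_def of_nat_diff diff_diff_eq)
  ultimately have "real_of_int (power_bdiff M (Suc i) k) =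
      (-1) ^ Suc i * (d (real k - real (Suc i)) - d (real k - real (Suc i) + 1))"
    by (simp add: right_diff_distrib)
  then show ?case by (simp only: d_def iterated_diff.simps replicate.simps)
qed simp

text \<open>
  The mean value theorem yields both facts needed about the weights: for \<open>i \<le> M\<close> they grow at most
  like \<open>k ^ (M - i)\<close>, and for \<open>i = M\<close> the power of \<open>\<xi>\<close> disappears and the value is exactly \<open>M!\<close>.
\<close>

lemma power_bdiff_mean_value:
  assumes "i \<le> k" "i \<le> M"
  obtains \<xi> where "0 \<le> \<xi>" "\<xi> \<le> real k"
    "real_of_int (power_bdiff M i k) = fact M / fact (M - i) * \<xi> ^ (M - i)"
proof -
  define F :: "nat \<Rightarrow> real \<Rightarrow> real" where "F j y = fact M / fact (M - j) * y ^ (M - j)" for j y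
  have der: "(F j has_real_derivative F (Suc j) y) (at y)" if "j < i" for j y
  proof -
    define d where "d = M - Suc j"
    have d: "M - j = Suc d" "M - Suc j = d"
      using that assms by (auto simp: d_def)
    have "((\<lambda>y. fact M / fact (Suc d) * y ^ Suc d) has_real_derivative
            fact M / fact (Suc d) * (real (Suc d) * y ^ d)) (at y)"
      by (intro DERIV_cmult DERIV_cong[OF DERIV_pow]) simp
    moreover have "fact M / fact (Suc d) * (real (Suc d) * y ^ d) = fact M / fact d * y ^ d"
      by (simp add: divide_simps del: of_nat_Suc)
    ultimately have "((\<lambda>y. fact M / fact (Suc d) * y ^ Suc d) has_real_derivative
            fact M / fact d * y ^ d) (at y)" by simp
    then show ?thesis by (simp only: F_def[abs_def] d)
  qed
  have "\<exists>\<xi>. real k - real i \<le> \<xi> \<and> \<xi> \<le> real k - real i + sum_list (replicate i 1) \<and>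
      iterated_diff (replicate i 1) (F 0) (real k - real i) =
      (\<Prod>h\<leftarrow>replicate i 1. - h) * F (length (replicate i (1::real))) \<xi>"
    by (intro iterated_diff_mean_value der) auto
  then obtain \<xi> where \<xi>: "real k - real i \<le> \<xi>" "\<xi> \<le> real k"
      "iterated_diff (replicate i 1) (F 0) (real k - real i) = (-1) ^ i * F i \<xi>"
    by (auto simp: sum_list_replicate)
  moreover have "F 0 = (\<lambda>y. y ^ M)" by (simp add: F_def [abs_def])
  ultimately have "real_of_int (power_bdiff M i k) = F i \<xi>"
    using assms by (simp add: power_bdiff_eq_iterated_diff)
  with \<xi> assms show ?thesis by (intro that[of \<xi>]) (auto simp: F_def)
qed

lemma power_bdiff_bound:
  assumes "i \<le> k" "i \<le> M"
  shows "\<bar>real_of_int (power_bdiff M i k)\<bar> \<le> fact M * real k ^ (M - i)"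
proof -
  obtain \<xi> where \<xi>: "0 \<le> \<xi>" "\<xi> \<le> real k"
    "real_of_int (power_bdiff M i k) = fact M / fact (M - i) * \<xi> ^ (M - i)"
    using assms by (rule power_bdiff_mean_value)
  have "fact M / fact (M - i) \<le> (fact M :: real)"
    using divide_left_mono[of 1 "fact (M - i)" "fact M :: real"] by (simp add: fact_ge_1)
  then have "fact M / fact (M - i) * \<xi> ^ (M - i) \<le> fact M * real k ^ (M - i)"
    using \<xi> by (intro mult_mono power_mono) auto
  then show ?thesis
    unfolding \<xi>(3) using \<xi>(1) by (subst abs_of_nonneg) auto
qed

lemma power_bdiff_eq_fact:
  assumes "M \<le> k"
  shows "power_bdiff M M k = fact M"
proof -
  have "real_of_int (power_bdiff M M k) = fact M"
    by (rule power_bdiff_mean_value[OF assms order_refl]) simp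
  then have "real_of_int (power_bdiff M M k) = real_of_int (fact M)" by (simp only: of_int_fact)
  then show ?thesis by (simp only: of_int_eq_iff)
qed

section \<open>Summation by parts\<close>

lemma summation_by_parts:
  fixes g D :: "nat \<Rightarrow> real"
  assumes "g 0 = 0"
  shows "(\<Sum>k = 1..K. g k * (D k - D (Suc k))) =
         (\<Sum>k = 1..K. (g k - g (k - 1)) * D k) - g K * D (Suc K)"
  by (induction K) (auto simp: assms algebra_simps)

text \<open>
  Each summation by parts moves one difference from \<open>wallis_log\<close> to the weight and leaves the boundary
  term \<open>g K * D j (K + 1)\<close>, which is of order \<open>K ^ (j + 1) / K ^ (j + 2) = 1 / K\<close>.
\<close>

lemma iterated_summation_by_parts:
  fixes M :: nat
  defines "D \<equiv> \<lambda>j k. iterated_diff (replicate j 1) wallis_log (real k)"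
  assumes "M \<ge> 1" "i \<le> M"
  shows "(\<lambda>K. (\<Sum>k = 1..K. real k ^ M * D M k)
            - (\<Sum>k = 1..K. real_of_int (power_bdiff M i k) * D (M - i) k)) \<longlonglongrightarrow> 0"
  using \<open>i \<le> M\<close>
proof (induction i)
  case (Suc i)
  define j where "j = M - Suc i"
  have j: "M - i = Suc j" "M - Suc i = j" using Suc.prems by (auto simp: j_def)
  have D: "D (Suc j) k = D j k - D j (Suc k)" for k
    by (simp add: D_def add.commute)
  define g where "g k = real_of_int (power_bdiff M i k)" for k
  have "(\<lambda>K. g K * D j (Suc K)) \<longlonglongrightarrow> 0"
  proof (rule Lim_null_comparison)
    show "\<forall>\<^sub>F K in sequentially. norm (g K * D j (Suc K)) \<le> fact M * fact (Suc j) / real K"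
      using eventually_ge_at_top[of "Suc i"]
    proof eventually_elim
      case (elim K)
      have K: "real K > 0" using elim by simp
      have "norm (g K * D j (Suc K)) \<le> (fact M * real K ^ Suc j) *
              (fact (Suc j) / (real (Suc K) - 1/2) ^ (j + 2))"
        unfolding real_norm_def abs_mult g_def D_def
        using elim Suc.prems power_bdiff_bound[of i K M] iterated_diff_wallis_log_bound[of "real (Suc K)" j]
        by (intro mult_mono) (auto simp: j)
      also have "\<dots> \<le> (fact M * real K ^ Suc j) * (fact (Suc j) / real K ^ (j + 2))"
        using K by (intro mult_left_mono divide_left_mono power_mono mult_pos_pos zero_less_power) auto
      also have "\<dots> = fact M * fact (Suc j) / real K"
        using K by (simp add: field_simps)
      finally show ?case .
    qed
    show "(\<lambda>K. fact M * fact (Suc j) / real K) \<longlonglongrightarrow> 0"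
      by (rule lim_const_over_n)
  qed
  with Suc.IH Suc.prems have
    "(\<lambda>K. ((\<Sum>k = 1..K. real k ^ M * D M k) - (\<Sum>k = 1..K. g k * D (Suc j) k))
        - g K * D j (Suc K)) \<longlonglongrightarrow> 0 - 0"
    unfolding g_def j by (intro tendsto_diff) auto
  moreover have "(\<Sum>k = 1..K. g k * D (Suc j) k) =
      (\<Sum>k = 1..K. (g k - g (k - 1)) * D j k) - g K * D j (Suc K)" for K
    unfolding D using assms by (intro summation_by_parts) (simp add: g_def)
  ultimately show ?case
    unfolding j by (simp add: g_def)
qed simp

section \<open>The infinite product\<close>

lemma tendsto_prod_exp_wallis_log:
  "(\<lambda>K. \<Prod>k = 1..K. exp (wallis_log (real k))) \<longlonglongrightarrow> pi / 2"
proof -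
  have "(\<Prod>k = 1..K. exp (wallis_log (real k))) = (\<Prod>k = 1..K. 4 * real k ^ 2 / (4 * real k ^ 2 - 1))" for K
    by (intro prod.cong) (auto simp: exp_wallis_log power2_eq_square algebra_simps)
  with wallis show ?thesis by simp
qed

theorem theorem5p5:
  fixes M :: nat
  assumes "M \<ge> 1"
  shows "\<exists>a b :: nat. a > 0 \<and> b > 0 \<and>
    (\<lambda>K. \<Prod>k = 1..K. W (M + 1) k ^ (k ^ M))
      \<longlonglongrightarrow> real a * pi ^ fact M / real b"
proof -
  define w where "w k = exp (wallis_log (real k))" for k
  define e where "e k = power_bdiff M M k - fact M" for k
  define R where "R = (\<Prod>k = 1..M. w k powi e k)"
  let ?S = "\<lambda>K. \<Sum>k = 1..K. real k ^ M * iterated_diff (replicate M 1) wallis_log (real k)"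
  let ?T = "\<lambda>K. \<Sum>k = 1..K. real_of_int (power_bdiff M M k) * wallis_log (real k)"
  \<comment> \<open>\<open>R\<close> collects the finitely many factors whose exponent differs from \<open>M!\<close>.\<close>
  have w_Rats: "w k \<in> \<rat>" if "k \<ge> 1" for k
    using that by (simp add: w_def exp_wallis_log)
  have "R \<in> \<rat>"
    unfolding R_def by (intro Rats_prod) (auto simp: power_int_def w_Rats)
  moreover have "R > 0"
    unfolding R_def by (intro prod_pos) (auto simp: w_def)
  ultimately obtain p q :: nat where pq: "q \<noteq> 0" "R = real p / real q"
    using Rats_abs_nat_div_natE[of R] by (metis abs_of_pos)
  with \<open>R > 0\<close> have "p > 0" by (cases p) auto
  \<comment> \<open>\<open>?S\<close> is the logarithm of the partial product, \<open>?T\<close> the sum after \<open>M\<close> summations by parts.\<close>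
  have lhs: "(\<Prod>k = 1..K. W (M + 1) k ^ (k ^ M)) = exp (?S K - ?T K) * exp (?T K)" for K
  proof -
    have "(\<Prod>k = 1..K. W (M + 1) k ^ (k ^ M)) = exp (?S K)"
      by (simp add: W_eq_exp_iterated_diff exp_sum exp_of_nat_mult flip: of_nat_power)
    also have "\<dots> = exp (?S K - ?T K) * exp (?T K)"
      by (simp only: diff_add_cancel flip: exp_add)
    finally show ?thesis .
  qed
  have T: "exp (?T K) = (\<Prod>k = 1..K. w k) ^ fact M * R" if "K \<ge> M" for K
  proof -
    have "exp (?T K) = (\<Prod>k = 1..K. w k powi (fact M + e k))"
      by (simp add: exp_sum w_def e_def exp_power_int)
    also have "\<dots> = (\<Prod>k = 1..K. w k ^ fact M * w k powi e k)"
      by (intro prod.cong) (simp_all add: power_int_add w_def flip: power_int_of_nat)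
    also have "\<dots> = (\<Prod>k = 1..K. w k) ^ fact M * (\<Prod>k = 1..K. w k powi e k)"
      by (simp add: prod.distrib prod_power_distrib)
    also have "(\<Prod>k = 1..K. w k powi e k) = R"
      unfolding R_def using that
      by (intro prod.mono_neutral_right) (auto simp: e_def power_bdiff_eq_fact)
    finally show ?thesis .
  qed
  have "(\<lambda>K. exp (?S K - ?T K)) \<longlonglongrightarrow> exp 0"
    using iterated_summation_by_parts[OF assms order_refl] by (intro tendsto_exp) simp
  moreover have "(\<lambda>K. (\<Prod>k = 1..K. w k) ^ fact M * R) \<longlonglongrightarrow> (pi / 2) ^ fact M * R"
    unfolding w_def by (intro tendsto_intros tendsto_prod_exp_wallis_log)
  then have "(\<lambda>K. exp (?T K)) \<longlonglongrightarrow> (pi / 2) ^ fact M * R"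
    by (rule Lim_transform_eventually) (rule eventually_mono[OF eventually_ge_at_top[of M]], simp only: T)
  ultimately have "(\<lambda>K. \<Prod>k = 1..K. W (M + 1) k ^ (k ^ M)) \<longlonglongrightarrow> exp 0 * ((pi / 2) ^ fact M * R)"
    unfolding lhs by (rule tendsto_mult)
  also have "exp 0 * ((pi / 2) ^ fact M * R) = real p * pi ^ fact M / real (2 ^ fact M * q)"
    by (simp add: pq power_divide)
  finally show ?thesis
    using pq \<open>p > 0\<close> by (intro exI[of _ p] exI[of _ "2 ^ fact M * q"]) auto
qed

end
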